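(* Any algorithm that decides whether a connected strongly-proportional allocation exists for $n$ (not necessarily hungry) agents with equal entitlements requires $\Omega(n\cdot 2^n)$ queries.
   Context: The cake is $C=[0,1]$, to be divided among agents $[n]$. Each agent $i$ has a valuation function $V_i$ on the algebra generated by intervals of $C$ that is non-negative, finitely additive, normalized ($V_i(C)=1$), with $x\mapsto V_i([0,x])$ continuous. Equal entitlements means each agent has entitlement $1/n$. An allocation is a partition $C=X_1\sqcup\cdots\sqcup X_n$ into finite unions of closed intervals, pairwise disjoint except possibly at endpoints; it is connected if each $X_i$ is a single interval and strongly-proportional if $V_i(X_i)>1/n$ for all $i$. Algorithms access valuations only via queries (each counts as one): $\textsc{Eval}_i(x,y)=V_i([x,y])$; $\textsc{Mark}_i(x,r)$ returns the largest $z\in C$ with $V_i([x,z])=r$, or $\infty$ if $V_i([x,1])<r$. *)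

theory Defs
  imports "HOL-Analysis.Analysis"
begin

definition cake :: "real set" where
  "cake = {0..1}"

text \<open>The algebra of subsets of the cake generated by the (open, closed or half-open,
  possibly degenerate) intervals contained in it.\<close>

definition interval_algebra :: "real set set" where
  "interval_algebra = \<Inter>{M. algebra cake M \<and> {I. is_interval I \<and> I \<subseteq> cake} \<subseteq> M}"

text \<open>Continuity of \<open>V [0,x]\<close> on the cake rules out atoms in \<open>(0,1]\<close> only.  The conjunct
  \<open>V {0} = 0\<close> rules out an atom at \<open>0\<close>, without which a query \<open>Mark i 0 r\<close> with
  \<open>0 \<le> r < V {0}\<close> would have no answer.\<close>

definition valuation :: "(real set \<Rightarrow> real) \<Rightarrow> bool" where
  "valuation V \<longleftrightarrow>
     (\<forall>A\<in>interval_algebra. 0 \<le> V A) \<and>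
     additive interval_algebra V \<and>
     V cake = 1 \<and>
     continuous_on cake (\<lambda>x. V {0..x}) \<and>
     V {0} = 0"

text \<open>Agents are \<open>1, \<dots>, n\<close>; components of a profile or an allocation at other indices
  are irrelevant.\<close>

type_synonym profile = "nat \<Rightarrow> real set \<Rightarrow> real"

definition valuation_profile :: "nat \<Rightarrow> profile \<Rightarrow> bool" where
  "valuation_profile n V \<longleftrightarrow> (\<forall>i\<in>{1..n}. valuation (V i))"

definition allocation :: "nat \<Rightarrow> (nat \<Rightarrow> real set) \<Rightarrow> bool" where
  "allocation n X \<longleftrightarrow>
     (\<forall>i\<in>{1..n}. \<exists>F. finite F \<and> F \<subseteq> {{a..b} | a b. a \<le> b} \<and> X i = \<Union>F) \<and>
     (\<Union>i\<in>{1..n}. X i) = cake \<and>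
     (\<forall>i\<in>{1..n}. \<forall>j\<in>{1..n}. i \<noteq> j \<longrightarrow> X i \<inter> X j \<subseteq> frontier (X i) \<inter> frontier (X j))"

definition connected_allocation :: "nat \<Rightarrow> (nat \<Rightarrow> real set) \<Rightarrow> bool" where
  "connected_allocation n X \<longleftrightarrow>
     allocation n X \<and> (\<forall>i\<in>{1..n}. \<exists>a b. a \<le> b \<and> X i = {a..b})"

definition strongly_proportional :: "nat \<Rightarrow> profile \<Rightarrow> (nat \<Rightarrow> real set) \<Rightarrow> bool" where
  "strongly_proportional n V X \<longleftrightarrow> (\<forall>i\<in>{1..n}. V i (X i) > 1 / real n)"

definition exists_connected_strongly_proportional :: "nat \<Rightarrow> profile \<Rightarrow> bool" where
  "exists_connected_strongly_proportional n V \<longleftrightarrow>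
     (\<exists>X. connected_allocation n X \<and> strongly_proportional n V X)"

datatype query =
    Eval nat real real
  | Mark nat real real

fun valid_query :: "nat \<Rightarrow> query \<Rightarrow> bool" where
  "valid_query n (Eval i x y) \<longleftrightarrow> i \<in> {1..n} \<and> x \<in> cake \<and> y \<in> cake \<and> x \<le> y"
| "valid_query n (Mark i x r) \<longleftrightarrow> i \<in> {1..n} \<and> x \<in> cake \<and> 0 \<le> r"

fun response :: "profile \<Rightarrow> query \<Rightarrow> ereal" where
  "response V (Eval i x y) = ereal (V i {x..y})"
| "response V (Mark i x r) =
     (if V i {x..1} < r then \<infinity>
      else ereal (GREATEST z. z \<in> cake \<and> V i {x..z} = r))"

text \<open>A deterministic adaptive algorithm: the list of answers received so far (oldest first)
  determines the next query or the final output.  The map is an arbitrary function, so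
  computation between queries is free and unrestricted, and termination is not built in.\<close>

datatype action = Ask query | Output bool

type_synonym algorithm = "ereal list \<Rightarrow> action"

primrec transcript :: "algorithm \<Rightarrow> profile \<Rightarrow> nat \<Rightarrow> ereal list" where
  "transcript A V 0 = []"
| "transcript A V (Suc k) =
     (case A (transcript A V k) of
        Ask q \<Rightarrow> transcript A V k @ [response V q]
      | Output b \<Rightarrow> transcript A V k)"

definition outputs :: "algorithm \<Rightarrow> profile \<Rightarrow> bool \<Rightarrow> bool" where
  "outputs A V b \<longleftrightarrow> (\<exists>k. A (transcript A V k) = Output b)"

text \<open>Meaningful only for runs that halt.\<close>

definition num_queries :: "algorithm \<Rightarrow> profile \<Rightarrow> nat" where
  "num_queries A V = (LEAST k. \<exists>b. A (transcript A V k) = Output b)"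

definition decides_connected_strongly_proportional :: "nat \<Rightarrow> algorithm \<Rightarrow> bool" where
  "decides_connected_strongly_proportional n A \<longleftrightarrow>
     (\<forall>as q. A as = Ask q \<longrightarrow> valid_query n q) \<and>
     (\<forall>V. valuation_profile n V \<longrightarrow>
        outputs A V (exists_connected_strongly_proportional n V))"

end

theory Submission
  imports Defs
begin

text \<open>
  There are \<open>n\<close> regular agents and one special agent, hence a share is \<open>1/(n+1)\<close>.  Every set \<open>S\<close>
  of regular agents gets its own spot \<open>p\<^sub>S\<close> in the cake; the spots of all sets of size \<open>k\<close> form layer
  \<open>k\<close>, in which they are ordered by decreasing binary code.  In layer \<open>k\<close> the distribution function
  of a regular agent \<open>i\<close> is \<open>F\<^sub>i(p\<^sub>S) = k/(n+1) + \<epsilon> (k code {i} - code S)\<close>, which increases with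
  slope \<open>\<epsilon>\<close> along the layer and satisfies \<open>F\<^sub>i(p\<^bsub>S \<union> {i}\<^esub>) = F\<^sub>i(p\<^sub>S) + 1/(n+1)\<close> exactly for
  every \<open>S\<close> without \<open>i\<close>.  The special agent is indifferent within layers: when served early, it
  pushes the cut beyond a whole layer, which is a loss that cannot be made up; when served last, it
  needs a cut to the left of \<open>p\<close> for the set of all regular agents.  So the cut after serving \<open>S\<close>
  cannot be to the left of \<open>p\<^sub>S\<close>, and there is no allocation.  Lowering \<open>F\<^sub>i\<close> in a small neighbourhood
  of a single \<open>p\<^sub>S\<close>, where \<open>i\<close> is not in \<open>S\<close>, lets \<open>i\<close> go after \<open>S\<close> with a gain that all later
  agents can share, so an allocation appears.  A query looks at the distribution function of one
  agent in two points and hence can notice at most two of these \<open>n (2\<^bsup>n-1\<^esup> - 1)\<close> perturbations.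
\<close>

section \<open>Valuations given by distribution functions\<close>

text \<open>Distribution functions live on \<open>[0,L]\<close>, where the instance has convenient
  coordinates; the factor \<open>L\<close> rescales them to the cake.\<close>

definition induced_profile :: "real \<Rightarrow> (nat \<Rightarrow> real \<Rightarrow> real) \<Rightarrow> profile" where
  "induced_profile L G i = measure (interval_measure (\<lambda>t. G i (L * t)))"

definition cdf_on :: "real \<Rightarrow> (real \<Rightarrow> real) \<Rightarrow> bool" where
  "cdf_on L g \<longleftrightarrow> 0 < L \<and> mono g \<and> continuous_on UNIV g \<and> g 0 = 0 \<and> g L = 1"

text \<open>The Borel subsets of the cake form an algebra containing its intervals, hence include
  the generated algebra. So a Borel measure can serve as a valuation.\<close>

lemma interval_algebra_subset_borel: "interval_algebra \<subseteq> sets borel \<inter> Pow cake"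
proof -
  have "algebra cake (sets borel \<inter> Pow cake)"
    by (auto simp: algebra_iff_Un cake_def)
  moreover have "{I. is_interval I \<and> I \<subseteq> cake} \<subseteq> sets borel \<inter> Pow cake"
    using real_interval_borel_measurable by blast
  ultimately show ?thesis
    unfolding interval_algebra_def by blast
qed

lemma scaled_cdf_continuous:
  assumes "cdf_on L g"
  shows "continuous_on A (\<lambda>t. g (L * t))"
proof -
  have "continuous_on UNIV g"
    using assms by (simp add: cdf_on_def)
  then show ?thesis
    by (rule continuous_on_compose2) (auto intro!: continuous_intros)
qed

lemma scaled_cdf_mono:
  assumes "cdf_on L g" "x \<le> y"
  shows "g (L * x) \<le> g (L * y)"
  using assms by (simp add: cdf_on_def monoD)

lemma emeasure_scaled_cdf:
  assumes "cdf_on L g" "a \<le> b"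
  shows "emeasure (interval_measure (\<lambda>t. g (L * t))) {a..b} = g (L * b) - g (L * a)"
  using assms by (intro emeasure_interval_measure_Icc scaled_cdf_mono scaled_cdf_continuous)

lemma induced_profile_Icc:
  assumes "cdf_on L (G i)" "a \<le> b"
  shows "induced_profile L G i {a..b} = G i (L * b) - G i (L * a)"
  unfolding induced_profile_def measure_def
  using assms by (simp add: emeasure_scaled_cdf scaled_cdf_mono)

lemma valuation_induced_profile:
  assumes g: "cdf_on L (G i)"
  shows "valuation (induced_profile L G i)"
proof -
  note Icc = induced_profile_Icc[where L = L and G = G and i = i, OF g]
  let ?\<mu> = "interval_measure (\<lambda>t. G i (L * t))"
  \<comment> \<open>Outside \<open>[0,L]\<close> the function \<open>G i\<close> may be unbounded
    and the whole line may have infinite measure; additivity of \<open>measure\<close> therefore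
    rests on the finite measure of the cake.\<close>
  have fin: "A \<in> fmeasurable ?\<mu>" if "A \<in> interval_algebra" for A
  proof (rule fmeasurableI2[of cake])
    show "cake \<in> fmeasurable ?\<mu>"
      using g by (auto simp: fmeasurable_def cake_def emeasure_scaled_cdf)
  qed (use that interval_algebra_subset_borel in auto)
  have "additive interval_algebra (induced_profile L G i)"
    unfolding additive_def induced_profile_def
    using fin by (auto intro!: measure_Un_AE)
  moreover have "continuous_on cake (\<lambda>x. induced_profile L G i {0..x})"
  proof (rule continuous_on_eq[OF scaled_cdf_continuous[OF g]])
    show "G i (L * x) = induced_profile L G i {0..x}" if "x \<in> cake" for x
      using that by (simp add: cake_def Icc) (use g in \<open>simp add: cdf_on_def\<close>)
  qed
  moreover have "induced_profile L G i {0} = 0"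
    using Icc[of 0 0] by simp
  moreover have "induced_profile L G i cake = 1"
    using g by (simp add: cake_def Icc) (simp add: cdf_on_def)
  ultimately show ?thesis
    by (simp add: valuation_def) (simp add: induced_profile_def)
qed

section \<open>Allocations as sequences of cuts\<close>

text \<open>Left-to-right reading of a connected allocation: the agents in \<open>T\<close> have
  been served and the current cut is at \<open>x\<close>. Claims about allocations become inductions
  over the serving order.\<close>

inductive reachable :: "nat \<Rightarrow> (nat \<Rightarrow> real \<Rightarrow> real) \<Rightarrow> nat set \<Rightarrow> real \<Rightarrow> bool" for N G where
  start: "reachable N G {} 0"
| serve: "reachable N G T x \<Longrightarrow> j \<in> {1..N} \<Longrightarrow> j \<notin> T \<Longrightarrow> x \<le> y \<Longrightarrow>
    G j x + 1 / real N < G j y \<Longrightarrow> reachable N G (insert j T) y"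

lemma reachable_imp_intervals:
  assumes "reachable N G T x"
  shows "finite T \<and> T \<subseteq> {1..N} \<and> 0 \<le> x \<and> (T = {} \<longrightarrow> x = 0) \<and> (\<exists>a b.
    (\<forall>i\<in>T. a i \<le> b i \<and> b i \<le> x \<and> G i (a i) + 1 / real N < G i (b i)) \<and>
    (T \<noteq> {} \<longrightarrow> (\<Union>i\<in>T. {a i..b i}) = {0..x}) \<and>
    (\<forall>i\<in>T. \<forall>j\<in>T. i \<noteq> j \<longrightarrow> b i \<le> a j \<or> b j \<le> a i))"
  using assms
proof induction
  case start
  then show ?case by simp
next
  case (serve T x j y)
  from serve.IH obtain a b where ab: "\<forall>i\<in>T. a i \<le> b i \<and> b i \<le> x \<and> G i (a i) + 1 / real N < G i (b i)"
    "T \<noteq> {} \<longrightarrow> (\<Union>i\<in>T. {a i..b i}) = {0..x}"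
    "\<forall>i\<in>T. \<forall>j\<in>T. i \<noteq> j \<longrightarrow> b i \<le> a j \<or> b j \<le> a i"
    by (elim conjE exE) (rule that)
  let ?a = "a(j := x)" and ?b = "b(j := y)"
  have eq: "(\<Union>i\<in>T. {?a i..?b i}) = (\<Union>i\<in>T. {a i..b i})"
    using serve.hyps(3) by (intro SUP_cong) auto
  have 1: "(\<Union>i\<in>insert j T. {?a i..?b i}) = {0..y}"
    using serve ab(2) eq by (cases "T = {}") auto
  have 2: "\<forall>i\<in>insert j T. ?a i \<le> ?b i \<and> ?b i \<le> y \<and> G i (?a i) + 1 / real N < G i (?b i)"
    using serve ab(1) by auto
  have 3: "\<forall>i\<in>insert j T. \<forall>k\<in>insert j T. i \<noteq> k \<longrightarrow> ?b i \<le> ?a k \<or> ?b k \<le> ?a i"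
    using ab(1,3) by auto
  show ?case
  proof (intro conjI; (rule exI[of _ ?a], rule exI[of _ ?b], intro conjI)?)
    show "finite (insert j T)" "insert j T \<subseteq> {1..N}" "0 \<le> y"
      using serve by auto
  qed (rule 1 2 3 impI | simp)+
qed

lemma reachable_imp_exists_allocation:
  assumes G: "\<And>i. i \<in> {1..N} \<Longrightarrow> cdf_on L (G i)" and "1 \<le> N" and r: "reachable N G {1..N} L"
  shows "exists_connected_strongly_proportional N (induced_profile L G)"
proof -
  have L: "0 < L"
    using G[of 1] \<open>1 \<le> N\<close> by (simp add: cdf_on_def)
  obtain a b
    where "\<forall>i\<in>{1..N}. a i \<le> b i \<and> b i \<le> L \<and> G i (a i) + 1 / real N < G i (b i)"
      and union: "{1..N} \<noteq> {} \<longrightarrow> (\<Union>i\<in>{1..N}. {a i..b i}) = {0..L}"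
      and "\<forall>i\<in>{1..N}. \<forall>j\<in>{1..N}. i \<noteq> j \<longrightarrow> b i \<le> a j \<or> b j \<le> a i"
    using reachable_imp_intervals[OF r] by (elim conjE exE) (rule that)
  then have ab: "\<And>i. i \<in> {1..N} \<Longrightarrow> a i \<le> b i"
    "\<And>i. i \<in> {1..N} \<Longrightarrow> G i (a i) + 1 / real N < G i (b i)"
    "\<And>i j. i \<in> {1..N} \<Longrightarrow> j \<in> {1..N} \<Longrightarrow> i \<noteq> j \<Longrightarrow> b i \<le> a j \<or> b j \<le> a i"
    by blast+
  have lt: "a i < b i" if "i \<in> {1..N}" for i
  proof -
    have "a i \<noteq> b i"
      using ab(2)[OF that] by (auto simp: add_strict_increasing dest: leD)
    then show ?thesis using ab(1)[OF that] by simp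
  qed
  define X where "X i = {a i / L..b i / L}" for i
  have le: "a i / L \<le> b i / L" "a i / L < b i / L" if "i \<in> {1..N}" for i
    using lt[OF that] L by (simp_all add: divide_strict_right_mono divide_right_mono)
  have X_iff: "t \<in> X i \<longleftrightarrow> L * t \<in> {a i..b i}" for t i
    using L by (simp add: X_def field_simps)
  have cover: "(\<Union>i\<in>{1..N}. X i) = cake"
  proof (intro set_eqI)
    fix t
    have "t \<in> (\<Union>i\<in>{1..N}. X i) \<longleftrightarrow> L * t \<in> (\<Union>i\<in>{1..N}. {a i..b i})"
      using X_iff by blast
    also have "\<dots> \<longleftrightarrow> t \<in> cake"
      using union L \<open>1 \<le> N\<close> by (simp add: cake_def zero_le_mult_iff)
    finally show "t \<in> (\<Union>i\<in>{1..N}. X i) \<longleftrightarrow> t \<in> cake" .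
  qed
  have overlap: "X i \<inter> X j \<subseteq> frontier (X i) \<inter> frontier (X j)"
    if "i \<in> {1..N}" "j \<in> {1..N}" "i \<noteq> j" for i j
  proof -
    have "b i / L \<le> a j / L \<or> b j / L \<le> a i / L"
      using ab(3)[OF that] L by (auto simp: divide_right_mono)
    then show ?thesis
      using le[OF that(1)] le[OF that(2)] by (auto simp: X_def frontier_def)
  qed
  have closed: "\<exists>F. finite F \<and> F \<subseteq> {{a..b} | a b. a \<le> b} \<and> X i = \<Union>F" if "i \<in> {1..N}" for i
    using le(1)[OF that] by (intro exI[of _ "{X i}"]) (auto simp: X_def)
  have "connected_allocation N X"
    unfolding connected_allocation_def allocation_def
  proof (intro conjI ballI impI)
    show "\<exists>a b. a \<le> b \<and> X i = {a..b}" if "i \<in> {1..N}" for i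
      using le(1)[OF that] X_def by blast
  qed (fact closed cover overlap)+
  moreover have "strongly_proportional N (induced_profile L G) X"
    unfolding strongly_proportional_def
  proof
    fix i assume i: "i \<in> {1..N}"
    show "1 / real N < induced_profile L G i (X i)"
      using ab(2)[OF i] L le(1)[OF i] G[OF i] by (simp add: X_def induced_profile_Icc)
  qed
  ultimately show ?thesis
    unfolding exists_connected_strongly_proportional_def by blast
qed

text \<open>Induction on the number of pieces that end by \<open>x\<close>. If \<open>j\<close> owns
  the piece that ends last, all others among them end by \<open>a j\<close>. A gap before
  \<open>a j\<close> is added to the piece of \<open>j\<close>, which loses nothing by
  monotonicity.\<close>

lemma disjoint_intervals_imp_reachable:
  assumes mono: "\<And>i. i \<in> {1..N} \<Longrightarrow> mono (G i)"
    and ab: "\<And>i. i \<in> {1..N} \<Longrightarrow> 0 \<le> a i \<and> a i < b i"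
    and val: "\<And>i. i \<in> {1..N} \<Longrightarrow> G i (a i) + 1 / real N < G i (b i)"
    and disj: "\<And>i j. i \<in> {1..N} \<Longrightarrow> j \<in> {1..N} \<Longrightarrow> i \<noteq> j \<Longrightarrow> b i \<le> a j \<or> b j \<le> a i"
    and "0 \<le> x"
  shows "\<exists>y\<le>x. reachable N G {i\<in>{1..N}. b i \<le> x} y"
  using \<open>0 \<le> x\<close>
proof (induction "card {i\<in>{1..N}. b i \<le> x}" arbitrary: x rule: less_induct)
  case less
  let ?T = "{i\<in>{1..N}. b i \<le> x}"
  show ?case
  proof (cases "?T = {}")
    case True
    then show ?thesis using less.prems reachable.start[of N G] by metis
  next
    case False
    have "finite (b ` ?T)" "b ` ?T \<noteq> {}" using False by auto
    from Max_in[OF this] obtain j where "j \<in> ?T" "b j = Max (b ` ?T)" by auto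
    then have j: "j \<in> ?T" "\<And>i. i \<in> ?T \<Longrightarrow> b i \<le> b j" by auto
    have T: "{i\<in>{1..N}. b i \<le> a j} = ?T - {j}"
    proof (intro set_eqI iffI)
      fix i assume "i \<in> ?T - {j}"
      then show "i \<in> {i\<in>{1..N}. b i \<le> a j}"
        using disj[of i j] j ab[of i] by force
    qed (use j ab[of j] in auto)
    have "card (?T - {j}) < card ?T"
      using j(1) by (intro psubset_card_mono) auto
    then obtain y where y: "y \<le> a j" "reachable N G (?T - {j}) y"
      using less.hyps[of "a j"] T ab[of j] j(1) by auto
    have "G j y \<le> G j (a j)"
      using mono[of j] j(1) y(1) by (auto dest: monoD)
    then have "reachable N G (insert j (?T - {j})) (b j)"
      using y j(1) ab[of j] val[of j] by (intro reachable.serve[OF y(2)]) auto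
    then show ?thesis
      using j(1) by (auto simp: insert_absorb)
  qed
qed

lemma exists_allocation_imp_reachable:
  assumes G: "\<And>i. i \<in> {1..N} \<Longrightarrow> cdf_on L (G i)"
    and ex: "exists_connected_strongly_proportional N (induced_profile L G)" and "1 \<le> N"
  shows "\<exists>y\<le>L. reachable N G {1..N} y"
proof -
  have L: "0 < L"
    using G[of 1] \<open>1 \<le> N\<close> by (simp add: cdf_on_def)
  obtain X where X: "connected_allocation N X" "strongly_proportional N (induced_profile L G) X"
    using ex unfolding exists_connected_strongly_proportional_def by blast
  then have "\<forall>i\<in>{1..N}. \<exists>a b. a \<le> b \<and> X i = {a..b}"
    by (simp add: connected_allocation_def)
  then obtain a b where ab: "\<And>i. i \<in> {1..N} \<Longrightarrow> a i \<le> b i" "\<And>i. i \<in> {1..N} \<Longrightarrow> X i = {a i..b i}"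
    by metis
  have val: "G i (L * a i) + 1 / real N < G i (L * b i)" if "i \<in> {1..N}" for i
    using X(2) that ab(1)[OF that] G[OF that]
    by (force simp: strongly_proportional_def ab(2) induced_profile_Icc)
  have lt: "a i < b i" if "i \<in> {1..N}" for i
  proof -
    have "a i \<noteq> b i"
      using val[OF that] by (auto simp: add_strict_increasing dest: leD)
    then show ?thesis using ab(1)[OF that] by simp
  qed
  have union: "(\<Union>i\<in>{1..N}. X i) = {0..1}"
    using X(1) by (simp add: connected_allocation_def allocation_def cake_def)
  have range: "0 \<le> a i" "b i \<le> 1" if "i \<in> {1..N}" for i
  proof -
    have "{a i..b i} \<subseteq> {0..1}"
      using union ab(2)[OF that] that by blast
    then show "0 \<le> a i" "b i \<le> 1"
      using ab(1)[OF that] by auto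
  qed
  \<comment> \<open>Overlapping pieces of positive length share a point \<open>m\<close> interior to
    both, which the frontier condition forbids.\<close>
  have disj: "b i \<le> a j \<or> b j \<le> a i" if "i \<in> {1..N}" "j \<in> {1..N}" "i \<noteq> j" for i j
  proof (rule ccontr)
    assume "\<not> (b i \<le> a j \<or> b j \<le> a i)"
    then have "max (a i) (a j) < min (b i) (b j)"
      using lt that by auto
    then obtain m where m: "max (a i) (a j) < m" "m < min (b i) (b j)"
      using dense by blast
    have "X i \<inter> X j \<subseteq> frontier (X i)"
      using X(1) that by (simp add: connected_allocation_def allocation_def)
    moreover have "m \<in> X i \<inter> X j"
      using m that by (simp add: ab(2))
    ultimately have "m \<in> frontier {a i..b i}"
      using ab(2)[OF that(1)] by auto
    then show False
      using m by (simp add: frontier_def)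
  qed
  have "\<exists>y\<le>L. reachable N G {i\<in>{1..N}. L * b i \<le> L} y"
  proof (rule disjoint_intervals_imp_reachable[where a = "\<lambda>i. L * a i" and b = "\<lambda>i. L * b i"])
    show "mono (G i)" if "i \<in> {1..N}" for i
      using G[OF that] by (simp add: cdf_on_def)
  qed (use L range lt val disj in auto)
  moreover have "{i\<in>{1..N}. L * b i \<le> L} = {1..N}"
    using L range by auto
  ultimately show ?thesis by simp
qed

section \<open>Indistinguishable profiles\<close>

lemma transcript_eq:
  assumes "\<And>j. j < k \<Longrightarrow> \<exists>q. A (transcript A V j) = Ask q \<and> response V q = response V' q"
  shows "transcript A V k = transcript A V' k"
  using assms
proof (induction k)
  case (Suc k)
  then obtain q where "A (transcript A V k) = Ask q" "response V q = response V' q"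
    by blast
  with Suc show ?case by simp
qed simp

text \<open>An output freezes the transcript, so outputs found at times \<open>k\<close> and
  \<open>l\<close> can be compared at time \<open>k + l\<close>.\<close>

lemma outputs_unique:
  assumes "A (transcript A V k) = Output b" "outputs A V c"
  shows "b = c"
proof -
  have stable: "A (transcript A V (k + d)) = Output b" if "A (transcript A V k) = Output b" for k d b
    using that by (induction d) auto
  obtain l where "A (transcript A V l) = Output c"
    using assms(2) by (auto simp: outputs_def)
  then show ?thesis
    using stable[OF assms(1), of l] stable[of l c k] by (simp add: add.commute)
qed

text \<open>If every query of the run on \<open>V\<close> had the same answer on
  \<open>V' p\<close>, the algorithm would wrongly output \<open>False\<close> there. Hence each
  \<open>p\<close> in \<open>P\<close> is detected by one of these queries, and each query detects
  at most \<open>d\<close>.\<close>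

lemma adversary_bound:
  assumes A: "decides_connected_strongly_proportional N A"
    and V: "valuation_profile N V" "\<not> exists_connected_strongly_proportional N V"
    and V': "\<And>p. p \<in> P \<Longrightarrow> valuation_profile N (V' p)"
      "\<And>p. p \<in> P \<Longrightarrow> exists_connected_strongly_proportional N (V' p)"
    and "finite P"
    and D: "\<And>q. valid_query N q \<Longrightarrow> card {p\<in>P. response V q \<noteq> response (V' p) q} \<le> d"
  shows "card P \<le> d * num_queries A V"
proof -
  let ?K = "num_queries A V"
  have out: "outputs A V False"
    using A V by (auto simp: decides_connected_strongly_proportional_def)
  then have "\<exists>k b. A (transcript A V k) = Output b"
    by (auto simp: outputs_def)
  then have "\<exists>b. A (transcript A V ?K) = Output b"
    unfolding num_queries_def by (rule LeastI_ex)
  then have K: "A (transcript A V ?K) = Output False"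
    using outputs_unique[OF _ out] by blast
  have "\<exists>q. A (transcript A V j) = Ask q" if "j < ?K" for j
    using not_less_Least[OF that[unfolded num_queries_def]] by (metis action.exhaust)
  then obtain q where q: "\<And>j. j < ?K \<Longrightarrow> A (transcript A V j) = Ask (q j)"
    by metis
  have "P \<subseteq> (\<Union>j<?K. {p\<in>P. response V (q j) \<noteq> response (V' p) (q j)})"
  proof
    fix p assume p: "p \<in> P"
    show "p \<in> (\<Union>j<?K. {p\<in>P. response V (q j) \<noteq> response (V' p) (q j)})"
    proof (rule ccontr)
      assume "\<not> ?thesis"
      then have "transcript A V ?K = transcript A (V' p) ?K"
        using p q by (intro transcript_eq) auto
      moreover have "outputs A (V' p) True"
        using A V'(1)[OF p] V'(2)[OF p] by (metis decides_connected_strongly_proportional_def)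
      ultimately show False
        using K outputs_unique by fastforce
    qed
  qed
  then have "card P \<le> card (\<Union>j<?K. {p\<in>P. response V (q j) \<noteq> response (V' p) (q j)})"
    using \<open>finite P\<close> by (intro card_mono) auto
  also have "\<dots> \<le> (\<Sum>j<?K. card {p\<in>P. response V (q j) \<noteq> response (V' p) (q j)})"
    by (rule card_UN_le) simp
  also have "\<dots> \<le> (\<Sum>j<?K. d)"
  proof (intro sum_mono D)
    fix j assume "j \<in> {..<?K}"
    then show "valid_query N (q j)"
      using A q by (auto simp: decides_connected_strongly_proportional_def)
  qed
  finally show ?thesis by (simp add: mult.commute)
qed


section \<open>What a single query reveals of a distribution function\<close>

fun query_agent :: "query \<Rightarrow> nat" where
  "query_agent (Eval i x y) = i"
| "query_agent (Mark i x r) = i"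

lemma response_cong:
  assumes "V (query_agent q) = V' (query_agent q)"
  shows "response V q = response V' q"
  using assms by (cases q) auto

lemma response_Mark_infinity:
  assumes "cdf_on L (G i)" "x \<in> cake" "1 - G i (L * x) < r"
  shows "response (induced_profile L G) (Mark i x r) = \<infinity>"
  using assms by (simp add: cake_def induced_profile_Icc) (simp add: cdf_on_def)

lemma response_Mark_finite:
  assumes G: "cdf_on L (G i)" "strict_mono (G i)"
    and z: "x \<in> cake" "z \<in> cake" "x \<le> z" "G i (L * z) = G i (L * x) + r"
  shows "response (induced_profile L G) (Mark i x r) = ereal z"
proof -
  let ?V = "induced_profile L G i"
  have L: "0 < L" "G i L = 1" "mono (G i)"
    using G(1) by (simp_all add: cdf_on_def)
  have "G i (L * z) \<le> G i L"
    using z(2) L(1) by (intro monoD[OF L(3)]) (simp add: cake_def mult_left_le)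
  then have "\<not> ?V {x..1} < r"
    using z L(2) by (simp add: cake_def induced_profile_Icc G(1))
  moreover have "(GREATEST y. y \<in> cake \<and> ?V {x..y} = r) = z"
  proof (rule Greatest_equality)
    show "z \<in> cake \<and> ?V {x..z} = r"
      using z by (simp add: induced_profile_Icc G(1))
    fix y assume y: "y \<in> cake \<and> ?V {x..y} = r"
    show "y \<le> z"
    proof (cases "x \<le> y")
      case True
      then have "G i (L * y) = G i (L * z)"
        using y z by (simp add: induced_profile_Icc G(1))
      then show ?thesis
        using G(2) L(1) by (simp add: strict_mono_eq)
    qed (use z in simp)
  qed
  ultimately show ?thesis by simp
qed

text \<open>For \<open>Eval\<close> the points are the ends of the interval. For \<open>Mark\<close>
  they are \<open>x\<close> and the answer, or \<open>x\<close> alone if the answer is infinite,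
  since the value of \<open>[x,1]\<close> depends only on the distribution function at
  \<open>x\<close>.\<close>

lemma response_determined_by_two_points:
  assumes q: "valid_query N q" and i: "query_agent q = i"
    and G: "cdf_on L (G i)" "strict_mono (G i)"
  obtains a b where "\<And>G'. cdf_on L (G' i) \<Longrightarrow> strict_mono (G' i) \<Longrightarrow>
    G' i (L * a) = G i (L * a) \<Longrightarrow> G' i (L * b) = G i (L * b) \<Longrightarrow>
    response (induced_profile L G) q = response (induced_profile L G') q"
proof (cases q)
  case (Eval j x y)
  then show thesis
    using q i G by (intro that[of x y]) (simp add: induced_profile_Icc)
next
  case (Mark j x r)
  then have q_eq: "q = Mark i x r" and x: "x \<in> cake" and "0 \<le> r"
    using q i by auto
  have L: "0 < L" "G i L = 1" "mono (G i)" "continuous_on UNIV (G i)"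
    using G(1) by (simp_all add: cdf_on_def)
  show thesis
  proof (cases "1 - G i (L * x) < r")
    case True
    show thesis
      by (rule that[of x x]) (use G x True in \<open>simp add: q_eq response_Mark_infinity del: response.simps\<close>)
  next
    case False
    have "\<exists>w\<ge>L * x. w \<le> L \<and> G i w = G i (L * x) + r"
    proof (rule IVT')
      show "L * x \<le> L"
        using x L(1) by (simp add: cake_def mult_left_le)
      show "continuous_on {L * x..L} (G i)"
        using L(4) continuous_on_subset by blast
    qed (use \<open>0 \<le> r\<close> False L(2) in simp_all)
    then obtain w where w: "L * x \<le> w" "w \<le> L" "G i w = G i (L * x) + r" by blast
    define z where "z = w / L"
    have z: "x \<le> z" "z \<in> cake" "L * z = w"
      using w x L(1) by (simp_all add: z_def cake_def field_simps)
        (metis L(1) mult_nonneg_nonneg order.strict_implies_order order_trans)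
    show thesis
      by (rule that[of x z])
        (use G x z w(3) in \<open>simp add: q_eq response_Mark_finite[where z = z] del: response.simps\<close>)
  qed
qed

section \<open>The layered instance\<close>

locale layered_instance =
  fixes n :: nat
  assumes n_pos: "1 \<le> n"
begin

text \<open>Distance between layers: for the regular agents a stretch of length \<open>n + 2\<close>
  between ramps and a ramp of width 1, for the special agent \<open>n + 1\<close> and 2.\<close>

definition period :: real where
  "period = real n + 3"

text \<open>End of the last ramp of width 2, which starts at \<open>n * period + n\<close>.\<close>

definition len :: real where
  "len = real n * period + real n + 2"

definition share :: real where
  "share = 1 / real (Suc n)"

text \<open>The epsilon of the overview, small enough for the ramp coefficients in
  \<open>regular\<close> to be nonnegative.\<close>

definition tilt :: real where
  "tilt = share\<^sup>2 / 2"

text \<open>Binary code, scaled into \<open>[0,1]\<close> for subsets of \<open>{1..n}\<close>: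
  injective on them and additive over disjoint unions.\<close>

definition code :: "nat set \<Rightarrow> real" where
  "code S = real (set_encode S) / real (set_encode {1..n})"

definition spot :: "nat set \<Rightarrow> real" where
  "spot S = real (card S) * period - code S"

text \<open>Staircase of \<open>n + 1\<close> unit steps; step \<open>j\<close> starts at
  \<open>j * period + n\<close> and has width \<open>d\<close>.\<close>

definition ramp :: "real \<Rightarrow> real \<Rightarrow> real" where
  "ramp d y = (\<Sum>j\<le>n. max 0 (min 1 ((y - real j * period - real n) / d)))"

text \<open>The last coefficient is what normalises the distribution function to \<open>1\<close> at \<open>len\<close>.\<close>

definition regular :: "nat \<Rightarrow> real \<Rightarrow> real" where
  "regular i y = tilt * y + (share - tilt * period + tilt * code {i}) * min (ramp 1 y) (real n)
     + (share - tilt * (real n + 2 + real n * code {i})) * max 0 (ramp 1 y - real n)"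

text \<open>The ramps of the special agent are wider: its value reaches \<open>n\<close> shares exactly at the spot of
  \<open>{1..n}\<close>, while this spot is an interior point of the layer of the regular agents.\<close>

definition base :: "nat \<Rightarrow> real \<Rightarrow> real" where
  "base i = (if i \<le> n then regular i else (\<lambda>y. share * ramp 2 y))"

text \<open>Half the spacing \<open>1 / set_encode {1..n}\<close> of the code values, so that the
  neighbourhoods of distinct spots are disjoint.\<close>

definition radius :: real where
  "radius = 1 / (2 * real (set_encode {1..n}))"

text \<open>Tent of slope 1/2: subtracting \<open>tilt\<close> times it keeps a function of slope at
  least \<open>tilt\<close> strictly increasing.\<close>

definition bump :: "nat set \<Rightarrow> real \<Rightarrow> real" where
  "bump S y = max 0 (radius - \<bar>y - spot S\<bar>) / 2"

definition perturbed :: "nat \<times> nat set \<Rightarrow> nat \<Rightarrow> real \<Rightarrow> real" where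
  "perturbed p j = (if j = fst p then (\<lambda>y. regular j y - tilt * bump (snd p) y) else base j)"

text \<open>The empty set is left out because its spot is \<open>0\<close>, where a distribution
  function has to vanish.\<close>

definition perturbations :: "(nat \<times> nat set) set" where
  "perturbations = (SIGMA i:{1..n}. Pow ({1..n} - {i}) - {{}})"

section \<open>Arithmetic of shares, codes and spots\<close>

lemma share_pos: "0 < share"
  by (simp add: share_def)

lemma share_sum: "(real n + 1) * share = 1"
  by (simp add: share_def field_simps)

lemma tilt_pos: "0 < tilt"
  using share_pos by (simp add: tilt_def)

lemma share_eq_tilt: "share = 2 * (real n + 1) * tilt"
proof -
  have "2 * (real n + 1) * tilt = ((real n + 1) * share) * share"
    by (simp add: tilt_def power2_eq_square)
  then show ?thesis by (simp add: share_sum)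
qed

lemma encode_all_ge: "2 \<le> set_encode {1..n}"
proof -
  have "2 ^ 1 \<le> (\<Sum>i\<in>{1..n}. 2 ^ i :: nat)"
    using n_pos by (intro member_le_sum) auto
  then show ?thesis by (simp add: set_encode_def)
qed

lemma code_nonneg: "0 \<le> code S"
  by (simp add: code_def)

lemma code_le_1:
  assumes "S \<subseteq> {1..n}"
  shows "code S \<le> 1"
proof -
  have "set_encode S \<le> set_encode {1..n}"
    using assms unfolding set_encode_def by (intro sum_mono2) auto
  then show ?thesis
    using encode_all_ge by (simp add: code_def)
qed

lemma code_empty [simp]: "code {} = 0"
  by (simp add: code_def)

lemma code_all: "code {1..n} = 1"
  using encode_all_ge by (simp add: code_def)

lemma code_insert:
  assumes "finite S" "i \<notin> S"
  shows "code (insert i S) = code S + code {i}"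
  using assms by (simp add: code_def add_divide_distrib)

lemma finite_subset_agents: "S \<subseteq> {1..n} \<Longrightarrow> finite S"
  by (rule finite_subset) auto

lemma card_subset_agents: "S \<subseteq> {1..n} \<Longrightarrow> card S \<le> n"
  using card_mono[of "{1..n}" S] by simp

lemma spot_insert:
  assumes "S \<subseteq> {1..n}" "i \<notin> S"
  shows "spot (insert i S) = spot S + period - code {i}"
  using assms finite_subset_agents[OF assms(1)]
  by (simp add: spot_def code_insert[where S = S] algebra_simps)

section \<open>The staircase\<close>

lemma ramp_mono:
  assumes "0 < d"
  shows "mono (ramp d)"
  unfolding ramp_def using assms
  by (intro monoI sum_mono max.mono min.mono divide_right_mono) auto

lemma ramp_continuous:
  assumes "0 < d"
  shows "continuous_on A (ramp d)"
  unfolding ramp_def using assms by (intro continuous_intros) auto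

text \<open>Step \<open>k - 1\<close> ends at \<open>k * period - 3 + d\<close> and step
  \<open>k\<close> starts at \<open>k * period + n\<close>; in between, exactly the first
  \<open>k\<close> steps are complete. The case \<open>k = Suc n\<close> is the stretch after the
  last step.\<close>

lemma ramp_eq:
  assumes "0 < d" "k \<le> Suc n" "real k * period - 3 + d \<le> y" "y \<le> real k * period + real n"
  shows "ramp d y = real k"
proof -
  have "max 0 (min 1 ((y - real j * period - real n) / d)) = (if j < k then 1 else 0)" for j
  proof (cases "j < k")
    case True
    then have "(real j + 1) * period \<le> real k * period"
      by (intro mult_right_mono) (auto simp: period_def)
    then have "1 \<le> (y - real j * period - real n) / d"
      using assms(1,3) by (simp add: field_simps) (simp add: period_def)
    then show ?thesis using True by simp
  next
    case False
    then have "real k * period \<le> real j * period"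
      by (intro mult_right_mono) (auto simp: period_def)
    then have "(y - real j * period - real n) / d \<le> 0"
      using assms(1,4) by (simp add: divide_le_0_iff)
    then show ?thesis using False by simp
  qed
  then have "ramp d y = real (card {j. j \<le> n \<and> j < k})"
    by (simp add: ramp_def sum.If_cases Int_def)
  also have "{j. j \<le> n \<and> j < k} = {..<k}"
    using assms(2) by auto
  finally show ?thesis by simp
qed

lemma ramp_len:
  assumes "0 < d" "d \<le> 2"
  shows "ramp d len = real n + 1"
  using ramp_eq[of d "Suc n" len] assms by (simp add: len_def algebra_simps) (simp add: period_def)

text \<open>With width 2, step \<open>n - 1\<close> ends exactly at \<open>n * period - 1\<close>,
  the spot of \<open>{1..n}\<close>. Further left it is incomplete and step \<open>n\<close> has not
  begun.\<close>

lemma ramp_less: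
  assumes "y < real n * period - 1"
  shows "ramp 2 y < real n"
proof -
  define f where "f j = max 0 (min 1 ((y - real j * period - real n) / 2))" for j :: nat
  have last: "f n = 0"
    using assms by (simp add: f_def)
  have "ramp 2 y = f n + (\<Sum>j<n. f j)"
    unfolding ramp_def f_def[symmetric] by (simp add: lessThan_Suc_atMost[symmetric])
  also have "\<dots> < (\<Sum>j<n. 1)"
    unfolding last add_0
  proof (rule sum_strict_mono_ex1)
    show "\<forall>j\<in>{..<n}. f j \<le> 1"
      by (simp add: f_def)
    have "f (n - 1) < 1"
      using assms n_pos by (simp add: f_def of_nat_diff algebra_simps) (simp add: period_def)
    then show "\<exists>j\<in>{..<n}. f j < 1"
      using n_pos by (intro bexI[of _ "n - 1"]) auto
  qed simp
  finally show ?thesis by simp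
qed

section \<open>Distribution functions of the agents\<close>

text \<open>A share is \<open>2 * (n + 1)\<close> tilts, which covers both \<open>period\<close> and
  \<open>n + 2 + n * code {i}\<close> tilts, as \<open>1 <= n\<close> and codes are at most
  1.\<close>

lemma ramp_slope_nonneg:
  assumes "i \<in> {1..n}"
  shows "0 \<le> share - tilt * period + tilt * code {i}"
    "0 \<le> share - tilt * (real n + 2 + real n * code {i})"
proof -
  have "tilt * period \<le> tilt * (2 * (real n + 1))"
    using tilt_pos n_pos by (intro mult_left_mono) (auto simp: period_def)
  moreover have "0 \<le> tilt * code {i}"
    using tilt_pos code_nonneg by simp
  ultimately show "0 \<le> share - tilt * period + tilt * code {i}"
    by (simp add: share_eq_tilt algebra_simps)
  have "real n * code {i} \<le> real n"
    using code_le_1[of "{i}"] assms by (simp add: mult_left_le)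
  then have "tilt * (real n + 2 + real n * code {i}) \<le> tilt * (2 * (real n + 1))"
    using tilt_pos by (intro mult_left_mono) auto
  then show "0 \<le> share - tilt * (real n + 2 + real n * code {i})"
    by (simp add: share_eq_tilt algebra_simps)
qed

text \<open>The ramp terms are nondecreasing, so the linear term bounds the growth from below. This
  leaves room for subtracting a bump.\<close>

lemma regular_increment:
  assumes "i \<in> {1..n}" "x \<le> y"
  shows "tilt * (y - x) \<le> regular i y - regular i x"
proof -
  have "ramp 1 x \<le> ramp 1 y"
    using ramp_mono[of 1] assms(2) by (simp add: monoD)
  then have "(share - tilt * period + tilt * code {i}) * min (ramp 1 x) (real n)
      \<le> (share - tilt * period + tilt * code {i}) * min (ramp 1 y) (real n)"
    "(share - tilt * (real n + 2 + real n * code {i})) * max 0 (ramp 1 x - real n)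
      \<le> (share - tilt * (real n + 2 + real n * code {i})) * max 0 (ramp 1 y - real n)"
    using ramp_slope_nonneg[OF assms(1)] by (intro mult_left_mono; simp)+
  then show ?thesis
    by (simp add: regular_def right_diff_distrib)
qed

lemma regular_strict_mono:
  assumes "i \<in> {1..n}"
  shows "strict_mono (regular i)"
proof (rule strict_monoI)
  fix x y :: real assume "x < y"
  then have "0 < tilt * (y - x)"
    using tilt_pos by simp
  then show "regular i x < regular i y"
    using regular_increment[OF assms, of x y] \<open>x < y\<close> by simp
qed

text \<open>After \<open>k\<close> steps the ramp coefficient has taken back the
  \<open>k * tilt * period\<close> that the linear term has accumulated.\<close>

lemma regular_layer:
  assumes "k \<le> n" "- 2 \<le> v" "v \<le> real n"
  shows "regular i (real k * period + v) = real k * share + tilt * (v + real k * code {i})"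
proof -
  have "ramp 1 (real k * period + v) = real k"
    using assms by (intro ramp_eq) auto
  then show ?thesis
    using assms(1) by (simp add: regular_def algebra_simps)
qed

lemma regular_len: "regular i len = 1"
proof -
  have "regular i len = (real n + 1) * share"
    by (simp add: regular_def ramp_len) (simp add: len_def algebra_simps)
  then show ?thesis by (simp add: share_sum)
qed

lemma regular_continuous: "continuous_on A (regular i)"
  unfolding regular_def by (intro continuous_intros ramp_continuous) auto

lemma len_pos: "0 < len"
  by (simp add: len_def period_def add_nonneg_pos)

lemma cdf_regular:
  assumes "i \<in> {1..n}"
  shows "cdf_on len (regular i)"
  using regular_layer[of 0 0 i] regular_len regular_continuous len_pos
    strict_mono_mono[OF regular_strict_mono[OF assms]]
  by (simp add: cdf_on_def)

lemma cdf_base: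
  assumes "i \<in> {1..Suc n}"
  shows "cdf_on len (base i)"
proof (cases "i \<le> n")
  case True
  then show ?thesis using assms cdf_regular by (simp add: base_def)
next
  case False
  have "ramp 2 0 = 0"
    using ramp_eq[of 2 0 0] by simp
  moreover have "mono (\<lambda>y. share * ramp 2 y)"
    using ramp_mono[of 2] share_pos by (auto simp: mono_def mult_left_mono)
  moreover have "share * ramp 2 len = 1"
    using share_sum by (simp add: ramp_len mult.commute)
  ultimately show ?thesis
    using False len_pos ramp_continuous[of 2 UNIV]
    by (simp add: base_def cdf_on_def continuous_intros)
qed

text \<open>The shifts \<open>a\<close> and \<open>b\<close> do not leave the layers, on which all regular agents have
  density \<open>tilt\<close>; at the spots themselves the value of the step is exactly one share.\<close>

lemma regular_step:
  assumes "T \<subseteq> {1..n}" "i \<in> {1..n}" "i \<notin> T" "\<bar>a\<bar> \<le> 1" "\<bar>b\<bar> \<le> 1"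
  shows "regular i (spot (insert i T) + b) = regular i (spot T + a) + share + tilt * (b - a)"
proof -
  have ins: "insert i T \<subseteq> {1..n}" and T: "finite T" "card (insert i T) = Suc (card T)"
    using assms finite_subset_agents[OF assms(1)] by auto
  have *: "regular i (spot S + c) = real (card S) * share + tilt * (c - code S + real (card S) * code {i})"
    if "S \<subseteq> {1..n}" "\<bar>c\<bar> \<le> 1" for S c
    using regular_layer[of "card S" "c - code S" i] card_subset_agents[OF that(1)]
      code_nonneg[of S] code_le_1[OF that(1)] that(2) n_pos
    by (simp add: spot_def algebra_simps abs_le_iff)
  show ?thesis
    unfolding *[OF ins assms(5)] *[OF assms(1,4)] T(2) code_insert[OF T(1) assms(3)]
    by (simp add: algebra_simps)
qed

section \<open>The unperturbed instance has no allocation\<close>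

text \<open>While the special agent waits, the step from \<open>spot T\<close> to the next spot is
  worth exactly one share, so a strict gain ends beyond that spot. Once it is served,
  \<open>card T\<close> counts it too, so the cut is one layer ahead of the regular agents served.
  The offset in this layer may shrink by 1 per step, which suffices as codes are at most 1. The
  bound \<open>card T <= n\<close> then excludes the full set.\<close>

lemma base_reachable_bound:
  assumes "reachable (Suc n) base T x" "x \<le> len"
  shows "finite T \<and> T \<subseteq> {1..Suc n} \<and> (Suc n \<notin> T \<longrightarrow> spot T \<le> x) \<and>
    (Suc n \<in> T \<longrightarrow> card T \<le> n \<and> real (card T) * period + (real n - real (card T)) \<le> x)"
  using assms
proof induction
  case start
  then show ?case by (simp add: spot_def)
next
  case (serve T x j y)
  then have IH: "finite T" "T \<subseteq> {1..Suc n}" "Suc n \<notin> T \<Longrightarrow> spot T \<le> x" "Suc n \<in> T \<Longrightarrow> card T \<le> n"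
    "Suc n \<in> T \<Longrightarrow> real (card T) * period + (real n - real (card T)) \<le> x"
    by auto
  have gain: "base j x + share < base j y"
    using serve.hyps by (simp add: share_def)
  have card: "card (insert j T) = Suc (card T)"
    using IH(1) serve.hyps by simp
  have mono: "base j u \<le> base j v" if "u \<le> v" for u v
    using cdf_base[of j] serve.hyps that by (simp add: cdf_on_def monoD)
  consider "Suc n \<notin> T" "j \<le> n" | "Suc n \<notin> T" "j = Suc n" | "Suc n \<in> T" "j \<le> n"
    using serve.hyps(2,3) by (cases "j = Suc n") auto
  then show ?case
  proof cases
    case 1
    then have T: "T \<subseteq> {1..n}" and j: "j \<in> {1..n}"
      using IH(2) serve.hyps by (auto simp: subset_iff le_Suc_eq)
    have "base j (spot (insert j T)) = base j (spot T) + share"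
      using regular_step[OF T j serve.hyps(3), of 0 0] 1 by (simp add: base_def)
    then have "base j (spot (insert j T)) < base j y"
      using mono[OF IH(3)[OF 1(1)]] gain by simp
    then have "spot (insert j T) \<le> y"
      using mono[of y "spot (insert j T)"] by linarith
    then show ?thesis using IH 1 serve.hyps by auto
  next
    case 2
    then have T: "T \<subseteq> {1..n}"
      using IH(2) by (auto simp: subset_iff le_Suc_eq)
    let ?k = "card T"
    \<comment> \<open>At \<open>spot T\<close> the special agent has exactly \<open>card T\<close>
      shares; to gain more than one it must cut beyond all of layer \<open>card T + 1\<close>. This
      also fails for \<open>T = {1..n}\<close>, since its total is \<open>n + 1\<close>
      shares.\<close>
    have "ramp 2 (spot T) = real ?k"
      using card_subset_agents[OF T] code_le_1[OF T] code_nonneg[of T]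
      by (intro ramp_eq) (auto simp: spot_def)
    then have "share * real ?k + share < share * ramp 2 y"
      using mono[OF IH(3)[OF 2(1)]] gain 2 by (simp add: base_def)
    then have less: "real ?k + 1 < ramp 2 y"
      using share_pos by (metis distrib_left mult.right_neutral mult_less_cancel_left_pos)
    have "ramp 2 y \<le> ramp 2 len"
      using serve.prems ramp_mono[of 2] by (simp add: monoD)
    then have k: "Suc ?k \<le> n"
      using less by (simp add: ramp_len)
    have "ramp 2 (real (Suc ?k) * period + real n) = real (Suc ?k)"
      using k by (intro ramp_eq) auto
    then have "real (Suc ?k) * period + real n \<le> y"
      using less monoD[OF ramp_mono[of 2], of y "real (Suc ?k) * period + real n"] by linarith
    then show ?thesis using IH 2 k card by auto
  next
    case 3
    then have j: "j \<in> {1..n}" using serve.hyps by auto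
    let ?k = "card T"
    have q: "base j (real k * period + (real n - real k))
        = real k * share + tilt * (real n - real k + real k * code {j})" if "k \<le> n" for k
      using regular_layer[of k "real n - real k" j] that 3 by (simp add: base_def)
    have y: "real ?k * share + tilt * (real n - real ?k + real ?k * code {j}) + share < base j y"
      using q[OF IH(4)[OF 3(1)]] mono[OF IH(5)[OF 3(1)]] gain by simp
    \<comment> \<open>With \<open>card T = n\<close> the agent already has at least \<open>n\<close>
      shares to the left of the cut, and more than one further share would exceed the total
      1.\<close>
    have "Suc ?k \<le> n"
    proof (rule ccontr)
      assume "\<not> Suc ?k \<le> n"
      then have k: "?k = n" using IH(4)[OF 3(1)] by simp
      have "0 \<le> tilt * (real n * code {j})"
        using tilt_pos code_nonneg by simp
      moreover have "base j y \<le> 1"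
        using mono[OF serve.prems] regular_len 3 by (simp add: base_def)
      ultimately show False
        using y share_sum unfolding k by (simp add: algebra_simps)
    qed
    moreover have "base j (real (Suc ?k) * period + (real n - real (Suc ?k))) < base j y"
    proof -
      have "tilt * code {j} \<le> tilt"
        using tilt_pos code_le_1[of "{j}"] j by (simp add: mult_left_le)
      then show ?thesis
        using y unfolding q[OF \<open>Suc ?k \<le> n\<close>] by (simp add: algebra_simps)
    qed
    then have "real (Suc ?k) * period + (real n - real (Suc ?k)) \<le> y"
      using mono[of y "real (Suc ?k) * period + (real n - real (Suc ?k))"] by linarith
    ultimately show ?thesis using IH 3 card serve.hyps by auto
  qed
qed

lemma base_no_allocation:
  "\<not> exists_connected_strongly_proportional (Suc n) (induced_profile len base)"
proof
  assume "exists_connected_strongly_proportional (Suc n) (induced_profile len base)"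
  then obtain y where "y \<le> len" "reachable (Suc n) base {1..Suc n} y"
    using exists_allocation_imp_reachable[where N = "Suc n" and G = base, OF cdf_base] by auto
  from base_reachable_bound[OF this(2,1)] show False by simp
qed

section \<open>Perturbing one distribution function near one spot\<close>

lemma radius_pos: "0 < radius"
  using encode_all_ge by (simp add: radius_def)

lemma radius_le: "radius \<le> 1 / 2"
  using encode_all_ge by (simp add: radius_def field_simps)

text \<open>Within a layer the codes are distinct multiples of \<open>2 * radius\<close>; spots of
  different layers are at least \<open>period - 1\<close> apart.\<close>

lemma spot_separated:
  assumes "S \<subseteq> {1..n}" "T \<subseteq> {1..n}" "S \<noteq> T"
  shows "2 * radius \<le> \<bar>spot S - spot T\<bar>"
proof (cases "card S = card T")
  case True
  have "set_encode S \<noteq> set_encode T"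
    using assms(3) set_encode_eq[OF assms(1,2)[THEN finite_subset_agents]] by simp
  then have "1 \<le> \<bar>real (set_encode S) - real (set_encode T)\<bar>"
    by linarith
  then have "1 / real (set_encode {1..n})
      \<le> \<bar>real (set_encode S) - real (set_encode T)\<bar> / real (set_encode {1..n})"
    by (intro divide_right_mono) auto
  also have "\<dots> = \<bar>code T - code S\<bar>"
    by (simp add: code_def diff_divide_distrib[symmetric] abs_minus_commute)
  finally show ?thesis
    using True by (simp add: spot_def radius_def)
next
  case False
  have *: "2 * radius \<le> spot T - spot S" if "S \<subseteq> {1..n}" "T \<subseteq> {1..n}" "card S < card T" for S T
  proof -
    have "(real (card S) + 1) * period \<le> real (card T) * period"
      using that(3) by (intro mult_right_mono) (auto simp: period_def)
    then show ?thesis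
      using code_nonneg[of S] code_le_1[OF that(2)] radius_le
      by (simp add: spot_def algebra_simps) (simp add: period_def)
  qed
  show ?thesis
    using False *[of S T] *[of T S] assms by linarith
qed

text \<open>Keeps the bump from changing the values at \<open>0\<close> and
  \<open>len\<close>.\<close>

lemma spot_range:
  assumes "S \<subseteq> {1..n}" "S \<noteq> {}"
  shows "radius \<le> spot S" "spot S + radius \<le> len"
proof -
  have "1 \<le> card S"
    using assms finite_subset_agents[of S] by (simp add: Suc_le_eq card_gt_0_iff)
  then have "1 * period \<le> real (card S) * period"
    by (intro mult_right_mono) (auto simp: period_def)
  moreover have "1 + radius \<le> period"
    using radius_le by (simp add: period_def)
  ultimately show "radius \<le> spot S"
    using code_le_1[OF assms(1)] unfolding spot_def by linarith
  have "real (card S) * period \<le> real n * period"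
    using card_subset_agents[OF assms(1)] by (intro mult_right_mono) (auto simp: period_def)
  then show "spot S + radius \<le> len"
    using code_nonneg[of S] radius_le by (simp add: spot_def len_def)
qed

lemma bump_eq_0: "radius \<le> \<bar>y - spot S\<bar> \<Longrightarrow> bump S y = 0"
  by (simp add: bump_def)

lemma bump_lipschitz: "x \<le> y \<Longrightarrow> bump S y - bump S x \<le> (y - x) / 2"
  by (simp add: bump_def max_def abs_if)

lemma perturbed_regular:
  assumes "(i, S) \<in> perturbations"
  shows "cdf_on len (perturbed (i, S) i)" "strict_mono (perturbed (i, S) i)"
proof -
  have i: "i \<in> {1..n}" and S: "S \<subseteq> {1..n}" "S \<noteq> {}"
    using assms by (auto simp: perturbations_def)
  have less: "perturbed (i, S) i x < perturbed (i, S) i y" if "x < y" for x y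
  proof -
    have "tilt * (bump S y - bump S x) \<le> tilt * ((y - x) / 2)"
      using bump_lipschitz[of x y S] that tilt_pos by (intro mult_left_mono) auto
    moreover have "tilt * (y - x) \<le> regular i y - regular i x"
      using regular_increment[OF i, of x y] that by simp
    moreover have "0 < tilt * (y - x)"
      using tilt_pos that by simp
    ultimately show ?thesis
      by (simp add: perturbed_def right_diff_distrib)
  qed
  then show strict: "strict_mono (perturbed (i, S) i)"
    by (rule strict_monoI)
  have "continuous_on UNIV (perturbed (i, S) i)"
    unfolding perturbed_def bump_def using regular_continuous by (auto intro!: continuous_intros)
  moreover have "bump S 0 = 0" "bump S len = 0"
    using spot_range[OF S] radius_pos by (auto intro!: bump_eq_0)
  ultimately show "cdf_on len (perturbed (i, S) i)"
    using cdf_regular[OF i] strict_mono_mono[OF strict] by (simp add: cdf_on_def perturbed_def)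
qed

lemma cdf_perturbed:
  assumes "p \<in> perturbations" "j \<in> {1..Suc n}"
  shows "cdf_on len (perturbed p j)"
proof (cases "j = fst p")
  case True
  then show ?thesis using perturbed_regular(1)[of "fst p" "snd p"] assms(1) by simp
qed (use cdf_base[OF assms(2)] in \<open>simp add: perturbed_def\<close>)

text \<open>Slack \<open>s\<close> is gained in every step except the one serving \<open>i\<close> after \<open>S\<close>, where the bump
  allows the cut to move \<open>n\<close> slacks to the left.\<close>

lemma perturbed_has_allocation:
  assumes p: "(i, S) \<in> perturbations"
  shows "exists_connected_strongly_proportional (Suc n) (induced_profile len (perturbed (i, S)))"
proof -
  let ?G = "perturbed (i, S)"
  have i: "i \<in> {1..n}" "i \<notin> S" and S: "S \<subseteq> {1..n}"
    using p by (auto simp: perturbations_def)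
  \<comment> \<open>Small enough that all offsets from the spots stay within 1 and that the bump at
    offset \<open>card S * s\<close> still exceeds \<open>n * s\<close>.\<close>
  define s where "s = radius / (4 * (real n + 1))"
  have s: "0 < s" "4 * (real n * s) + 4 * s = radius"
  proof -
    show "0 < s"
      using radius_pos by (simp add: s_def)
    have "4 * (real n * s) + 4 * s = s * (4 * (real n + 1))"
      by (simp add: algebra_simps)
    also have "\<dots> = radius"
      using s_def nonzero_eq_divide_eq[of "4 * (real n + 1)" s radius] of_nat_0_le_iff[of n] by force
    finally show "4 * (real n * s) + 4 * s = radius" .
  qed
  have ks: "real k * s \<le> real n * s" if "k \<le> n" for k
    using that s(1) by (intro mult_right_mono) auto
  have ns: "0 \<le> real k * s" for k
    using s(1) by simp
  have shift: "\<bar>real k * s\<bar> \<le> 1" "\<bar>real k * s - (real n + 1) * s\<bar> \<le> 1" if "k \<le> n" for k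
    using ks[OF that] ns[of k] ns[of n] s radius_le unfolding abs_le_iff distrib_right by linarith+
  have step: "reachable (Suc n) ?G (insert j T) (spot (insert j T) + b)"
    if "reachable (Suc n) ?G T (spot T + a)" "T \<subseteq> {1..n}" "j \<in> {1..n}" "j \<notin> T"
      "\<bar>a\<bar> \<le> 1" "\<bar>b\<bar> \<le> 1" "?G j (spot T + a) + share < ?G j (spot (insert j T) + b)" for T j a b
  proof (rule reachable.serve[OF that(1)])
    show "spot T + a \<le> spot (insert j T) + b"
      using spot_insert[OF that(2,4)] code_le_1[of "{j}"] that(3,5,6)
      by (simp add: period_def abs_le_iff)
  qed (use that in \<open>auto simp: share_def\<close>)
  have other: "?G j (spot T + a) + share < ?G j (spot (insert j T) + b)"
    if "T \<subseteq> {1..n}" "j \<in> {1..n}" "j \<notin> T" "j \<noteq> i" "\<bar>a\<bar> \<le> 1" "\<bar>b\<bar> \<le> 1" "a < b" for T j a b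
    using regular_step[OF that(1-3,5,6)] that tilt_pos by (simp add: perturbed_def base_def)
  \<comment> \<open>Agents in \<open>S\<close> differ from \<open>i\<close> and keep their regular
    functions, so a strict gain needs a growing offset from the spots: one slack per agent.\<close>
  have before: "reachable (Suc n) ?G T (spot T + real (card T) * s)" if "finite T" "T \<subseteq> S" for T
    using that
  proof (induction T)
    case empty
    show ?case using reachable.start by (simp add: spot_def)
  next
    case (insert j T)
    have T: "T \<subseteq> {1..n}" "j \<in> {1..n}" "j \<noteq> i" "insert j T \<subseteq> {1..n}"
      using insert.prems S i by auto
    show ?case
      using insert T shift(1)[OF card_subset_agents[OF T(1)]] shift(1)[OF card_subset_agents[OF T(4)]] s(1)
      by (intro step[where a = "real (card T) * s"] other) auto
  qed
  \<comment> \<open>The offset drops by \<open>n * s\<close>, so that after one further slack for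
    each later agent it ends at \<open>- s\<close> for \<open>{1..n}\<close>.\<close>
  have at: "reachable (Suc n) ?G (insert i S)
      (spot (insert i S) + (real (card (insert i S)) * s - (real n + 1) * s))"
  proof -
    let ?a = "real (card S) * s"
    let ?b = "real (card (insert i S)) * s - (real n + 1) * s"
    have ins: "insert i S \<subseteq> {1..n}" using S i by auto
    have a: "\<bar>?a\<bar> \<le> 1" and b: "\<bar>?b\<bar> \<le> 1"
      using shift(1)[OF card_subset_agents[OF S]] shift(2)[OF card_subset_agents[OF ins]] by auto
    have ba: "?b - ?a = - (real n * s)"
      using finite_subset_agents[OF S] i(2) by (simp add: algebra_simps)
    have le: "?a \<le> real n * s"
      by (rule ks[OF card_subset_agents[OF S]])
    have "?a \<le> radius"
      using le s ns[of n] by linarith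
    then have bump: "bump S (spot S + ?a) = (radius - ?a) / 2"
      using ns[of "card S"] by (simp add: bump_def)
    have "real n * s < bump S (spot S + ?a)"
    proof -
      have "m < (r - a) / 2" if "a \<le> m" "0 \<le> m" "4 * m + 4 * s = r" for m r a
        using that s(1) by simp
      from this[OF le ns s(2)] show ?thesis
        unfolding bump .
    qed
    then have "tilt * (real n * s) < tilt * bump S (spot S + ?a)"
      using tilt_pos by simp
    moreover have "bump S (spot (insert i S) + ?b) = 0"
    proof (rule bump_eq_0)
      have "1 \<le> spot (insert i S) + ?b - spot S"
        using spot_insert[OF S i(2)] code_le_1[of "{i}"] i(1) b by (simp add: period_def abs_le_iff)
      then show "radius \<le> \<bar>spot (insert i S) + ?b - spot S\<bar>"
        using radius_le by linarith
    qed
    moreover have "regular i (spot (insert i S) + ?b)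
        = regular i (spot S + ?a) + share - tilt * (real n * s)"
      unfolding regular_step[OF S i a b] ba by simp
    ultimately show ?thesis
      using before[OF finite_subset_agents[OF S] subset_refl] S i a b
      by (intro step[where a = ?a]) (auto simp: perturbed_def)
  qed
  have after: "reachable (Suc n) ?G (insert i S \<union> U)
      (spot (insert i S \<union> U) + (real (card (insert i S \<union> U)) * s - (real n + 1) * s))"
    if "finite U" "U \<subseteq> {1..n} - insert i S" for U
    using that
  proof (induction U)
    case empty
    show ?case using at by simp
  next
    case (insert j U)
    let ?T = "insert i S \<union> U"
    have T: "?T \<subseteq> {1..n}" "j \<in> {1..n}" "j \<noteq> i" "insert j ?T \<subseteq> {1..n}" "j \<notin> ?T"
      using insert.prems insert.hyps S i by auto
    have "card (insert j ?T) = Suc (card ?T)"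
      using T finite_subset_agents[OF T(1)] by simp
    then have "real (card ?T) * s - (real n + 1) * s < real (card (insert j ?T)) * s - (real n + 1) * s"
      using s(1) by simp
    moreover have "reachable (Suc n) ?G ?T (spot ?T + (real (card ?T) * s - (real n + 1) * s))"
      using insert by simp
    ultimately have "reachable (Suc n) ?G (insert j ?T)
        (spot (insert j ?T) + (real (card (insert j ?T)) * s - (real n + 1) * s))"
      using T shift(2)[OF card_subset_agents[OF T(1)]] shift(2)[OF card_subset_agents[OF T(4)]]
      by (intro step[where a = "real (card ?T) * s - (real n + 1) * s"] other) auto
    then show ?case by simp
  qed
  have "insert i S \<union> ({1..n} - insert i S) = {1..n}"
    using S i by auto
  then have "reachable (Suc n) ?G {1..n} (spot {1..n} + (real n * s - (real n + 1) * s))"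
    using after[of "{1..n} - insert i S"] by simp
  moreover have "spot {1..n} + (real n * s - (real n + 1) * s) = real n * period - 1 - s"
    unfolding spot_def code_all by (simp add: algebra_simps)
  ultimately have all: "reachable (Suc n) ?G {1..n} (real n * period - 1 - s)"
    by (simp only:)
  have "reachable (Suc n) ?G (insert (Suc n) {1..n}) len"
  proof (rule reachable.serve[OF all])
    \<comment> \<open>The cut is left of the spot of \<open>{1..n}\<close>, so the special agent,
      served last, gets strictly more than one share.\<close>
    have "ramp 2 (real n * period - 1 - s) < real n"
      using s(1) by (intro ramp_less) simp
    then have "share * (ramp 2 (real n * period - 1 - s) + 1) < share * ramp 2 len"
      using share_pos by (simp add: ramp_len)
    then show "?G (Suc n) (real n * period - 1 - s) + 1 / real (Suc n) < ?G (Suc n) len"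
      using i by (simp add: perturbed_def base_def algebra_simps share_def)
  qed (use s(1) in \<open>auto simp: len_def\<close>)
  moreover have "insert (Suc n) {1..n} = {1..Suc n}"
    by auto
  ultimately show ?thesis
    using reachable_imp_exists_allocation[OF cdf_perturbed[OF p]] by simp
qed

section \<open>Counting the perturbations that a query detects\<close>

lemma card_spots_near:
  "finite {S. S \<subseteq> {1..n} \<and> \<bar>y - spot S\<bar> < radius} \<and> card {S. S \<subseteq> {1..n} \<and> \<bar>y - spot S\<bar> < radius} \<le> 1"
proof -
  let ?A = "{S. S \<subseteq> {1..n} \<and> \<bar>y - spot S\<bar> < radius}"
  have "S = T" if "S \<in> ?A" "T \<in> ?A" for S T
    using spot_separated[of S T] that by fastforce
  moreover have "finite ?A"
    by (rule finite_subset[of _ "Pow {1..n}"]) auto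
  ultimately show ?thesis
    using card_le_Suc0_iff_eq[of ?A] by simp
qed

text \<open>Only perturbations of the queried agent matter, hence none if it is the special one.
  Otherwise the answer depends on two points, each within \<open>radius\<close> of at most one
  spot.\<close>

lemma card_detected_le:
  assumes q: "valid_query (Suc n) q"
  shows "card {p\<in>perturbations. response (induced_profile len base) q
    \<noteq> response (induced_profile len (perturbed p)) q} \<le> 2" (is "card ?D \<le> 2")
proof -
  define D where "D = ?D"
  define i where "i = query_agent q"
  have agent: "fst p = i" if "p \<in> D" for p
  proof (rule ccontr)
    assume "fst p \<noteq> i"
    then have "induced_profile len base i = induced_profile len (perturbed p) i"
      by (simp add: induced_profile_def perturbed_def)
    then have "response (induced_profile len base) q = response (induced_profile len (perturbed p)) q"
      unfolding i_def by (rule response_cong)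
    then show False
      using that by (simp add: D_def)
  qed
  have "card D \<le> 2"
  proof (cases "i \<in> {1..n}")
    case False
    have "fst p \<in> {1..n}" if "p \<in> D" for p
      using that by (auto simp: D_def perturbations_def)
    then have "D = {}"
      using agent False by fastforce
    then show ?thesis by simp
  next
    case True
    have base: "base i = regular i"
      using True by (simp add: base_def)
    obtain a b where ab: "\<And>G'. cdf_on len (G' i) \<Longrightarrow> strict_mono (G' i) \<Longrightarrow>
      G' i (len * a) = base i (len * a) \<Longrightarrow> G' i (len * b) = base i (len * b) \<Longrightarrow>
      response (induced_profile len base) q = response (induced_profile len G') q"
      using response_determined_by_two_points[OF q i_def[symmetric], of len base]
        cdf_regular[OF True] regular_strict_mono[OF True] base by metis
    let ?near = "\<lambda>y. {S. S \<subseteq> {1..n} \<and> \<bar>y - spot S\<bar> < radius}"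
    have "D \<subseteq> Pair i ` (?near (len * a) \<union> ?near (len * b))"
    proof
      fix p assume p: "p \<in> D"
      obtain S where S: "p = (i, S)"
        using agent[OF p] by (cases p) auto
      have "S \<subseteq> {1..n}" and pS: "(i, S) \<in> perturbations"
        using p S by (auto simp: D_def perturbations_def)
      moreover have "\<bar>len * a - spot S\<bar> < radius \<or> \<bar>len * b - spot S\<bar> < radius"
      proof (rule ccontr)
        assume "\<not> ?thesis"
        then have "response (induced_profile len base) q = response (induced_profile len (perturbed p)) q"
          using perturbed_regular[OF pS] unfolding S
          by (intro ab) (auto simp: perturbed_def base bump_eq_0)
        then show False using p by (simp add: D_def)
      qed
      ultimately show "p \<in> Pair i ` (?near (len * a) \<union> ?near (len * b))"
        using S by auto
    qed
    then have "card D \<le> card (?near (len * a) \<union> ?near (len * b))"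
      using card_spots_near by (meson card_image_le card_mono finite_UnI finite_imageI order_trans)
    also have "\<dots> \<le> card (?near (len * a)) + card (?near (len * b))"
      by (rule card_Un_le)
    also have "\<dots> \<le> 2"
      using card_spots_near[of "len * a"] card_spots_near[of "len * b"] by linarith
    finally show ?thesis .
  qed
  then show ?thesis by (simp add: D_def)
qed

lemma card_perturbations: "card perturbations = n * (2 ^ (n - 1) - 1)"
proof -
  have "card (Pow ({1..n} - {i}) - {{}}) = 2 ^ (n - 1) - 1" if "i \<in> {1..n}" for i
    using that by (simp add: card_Diff_subset card_Pow)
  then show ?thesis
    by (simp add: perturbations_def)
qed

lemma finite_perturbations: "finite perturbations"
  by (simp add: perturbations_def)

lemma query_lower_bound:
  assumes A: "decides_connected_strongly_proportional (Suc n) A"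
  shows "\<exists>V. valuation_profile (Suc n) V \<and> n * (2 ^ (n - 1) - 1) \<le> 2 * num_queries A V"
proof (intro exI conjI)
  show "valuation_profile (Suc n) (induced_profile len base)"
    using cdf_base valuation_induced_profile by (simp add: valuation_profile_def)
  then have "card perturbations \<le> 2 * num_queries A (induced_profile len base)"
  proof (rule adversary_bound[where V' = "\<lambda>p. induced_profile len (perturbed p)", OF A])
    show "valuation_profile (Suc n) (induced_profile len (perturbed p))" if "p \<in> perturbations" for p
      using cdf_perturbed[OF that] valuation_induced_profile by (simp add: valuation_profile_def)
    show "exists_connected_strongly_proportional (Suc n) (induced_profile len (perturbed p))"
      if "p \<in> perturbations" for p
      using perturbed_has_allocation[of "fst p" "snd p"] that by simp
  qed (use base_no_allocation finite_perturbations card_detected_le in auto)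
  then show "n * (2 ^ (n - 1) - 1) \<le> 2 * num_queries A (induced_profile len base)"
    by (simp add: card_perturbations)
qed

end

theorem theorem9:
  "\<exists>c>0. \<forall>\<^sub>F n in sequentially. \<forall>A.
     decides_connected_strongly_proportional n A \<longrightarrow>
     (\<exists>V. valuation_profile n V \<and> c * (real n * 2 ^ n) \<le> real (num_queries A V))"
proof (intro exI conjI)
  \<comment> \<open>With \<open>N = n + 1 = m + 3\<close>, the factor 32 is made up of 8 from
    \<open>2 ^ N = 8 * 2 ^ m\<close>, 2 from \<open>N <= 2 * n\<close>, and 2 from the two
    perturbations a query may detect; the remaining step is
    \<open>2 ^ m <= 2 * 2 ^ m - 1\<close>.\<close>
  show "(0 :: real) < 1 / 32" by simp
  have "\<exists>V. valuation_profile N V \<and> 1 / 32 * (real N * 2 ^ N) \<le> real (num_queries A V)"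
    if "3 \<le> N" and A: "decides_connected_strongly_proportional N A" for N A
  proof -
    define n where "n = N - 1"
    define m where "m = N - 3"
    have n: "N = Suc n" "n = m + 2" "1 \<le> n"
      using that(1) by (auto simp: n_def m_def)
    interpret layered_instance n by unfold_locales (fact n(3))
    obtain V where V: "valuation_profile N V" "n * (2 ^ (n - 1) - 1) \<le> 2 * num_queries A V"
      using query_lower_bound A n(1) by auto
    have "real (2 ^ (n - 1) - 1) = 2 * 2 ^ m - 1"
      by (simp add: n(2) of_nat_diff)
    moreover have "real n * real (2 ^ (n - 1) - 1) \<le> 2 * real (num_queries A V)"
      using V(2) by (metis of_nat_le_iff of_nat_mult of_nat_numeral)
    ultimately have K: "real n * (2 * 2 ^ m - 1) \<le> 2 * real (num_queries A V)"
      by simp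
    have "1 / 32 * (real N * 2 ^ N) = (real n + 1) * (2 ^ m / 4)"
      by (simp add: n(1)) (simp add: n(2))
    also have "\<dots> \<le> (2 * real n) * (2 ^ m / 4)"
      using n(3) by (intro mult_right_mono) auto
    also have "\<dots> \<le> real n * ((2 * 2 ^ m - 1) / 2)"
    proof -
      have "(1 :: real) \<le> 2 ^ m" by simp
      then have "(2 :: real) * (2 ^ m / 4) \<le> (2 * 2 ^ m - 1) / 2" by simp
      from mult_left_mono[OF this, of "real n"] show ?thesis by (simp only: mult_ac of_nat_0_le_iff)
    qed
    also have "\<dots> \<le> real (num_queries A V)"
      using K by simp
    finally show ?thesis using V(1) by blast
  qed
  then show "\<forall>\<^sub>F N in sequentially. \<forall>A. decides_connected_strongly_proportional N A \<longrightarrow>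
     (\<exists>V. valuation_profile N V \<and> 1 / 32 * (real N * 2 ^ N) \<le> real (num_queries A V))"
    by (auto simp: eventually_sequentially intro!: exI[of _ 3])
qed

end
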